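(* For every $n\ge 1$, $$\max_{A\in \mathrm{GL}_n(\mathbb R)}\left(\rho^{\mathrm{GEPP}}(A)-\rho^{\mathrm{GECP}}(A)\right)=2^{n-1}-1 .$$
   Context: All computations are in exact arithmetic. Gaussian elimination (GE) on $A\in\mathrm{GL}_n(\mathbb R)$ produces matrices $A=A^{(1)},A^{(2)},\dots,A^{(n)}$, where $A^{(k)}$ has zeros below its first $k-1$ diagonal entries. At step $k$ ($1\le k\le n-1$) a pivoting strategy first possibly swaps rows/columns with indices $\ge k$ of $A^{(k)}$, and then, for each $i>k$, the multiple $L_{ik}=A^{(k)}_{ik}/A^{(k)}_{kk}$ of row $k$ is subtracted from row $i$, giving $A^{(k+1)}$. GE with partial pivoting (GEPP): at step $k$ one row swap brings to position $(k,k)$ an entry of maximal absolute value among $A^{(k)}_{ik}$, $i\ge k$. GE with complete pivoting (GECP): at step $k$ one row swap and one column swap bring to position $(k,k)$ an entry of maximal absolute value among all $A^{(k)}_{ij}$, $i,j\ge k$. Ties are broken by choosing the smallest row index (then the smallest column index); in particular no swap is done when the diagonal entry is already maximal for GEPP. The growth factor under a given strategy is $\rho(A)=\dfrac{\max_{i,j,k}|A^{(k)}_{ij}|}{\max_{i,j}|A_{ij}|}$; it is denoted $\rho^{\mathrm{GEPP}}$ and $\rho^{\mathrm{GECP}}$ for the two strategies. *)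

theory Defs
  imports
    Complex_Main
    "Jordan_Normal_Form.Gauss_Jordan_Elimination"
    "Jordan_Normal_Form.Column_Operations"
begin

text \<open>Matrix indices and elimination steps are counted from 0: step \<open>k\<close> below is the step
  with number \<open>k + 1\<close> in the usual 1-based numbering.\<close>

definition GL :: "nat \<Rightarrow> real mat set" where
  "GL n = {A \<in> carrier_mat n n. invertible_mat A}"

text \<open>A pivoting strategy maps the step \<open>k\<close> and the current matrix to the row and column index
  of the entry to be moved to position \<open>(k, k)\<close>; an index equal to \<open>k\<close> means that no swap is done.\<close>

type_synonym pivoting = "nat \<Rightarrow> real mat \<Rightarrow> nat \<times> nat"

definition gepp_pivot :: pivoting where
  "gepp_pivot k A =
    (LEAST i. i \<in> {k..<dim_row A} \<and>
       (\<forall>i' \<in> {k..<dim_row A}. \<bar>A $$ (i', k)\<bar> \<le> \<bar>A $$ (i, k)\<bar>),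
     k)"

definition is_gecp_pivot :: "nat \<Rightarrow> real mat \<Rightarrow> nat \<Rightarrow> nat \<Rightarrow> bool" where
  "is_gecp_pivot k A i j \<longleftrightarrow>
     i \<in> {k..<dim_row A} \<and> j \<in> {k..<dim_col A} \<and>
     (\<forall>i' \<in> {k..<dim_row A}. \<forall>j' \<in> {k..<dim_col A}. \<bar>A $$ (i', j')\<bar> \<le> \<bar>A $$ (i, j)\<bar>)"

definition gecp_pivot :: pivoting where
  "gecp_pivot k A =
    (let i = (LEAST i. \<exists>j. is_gecp_pivot k A i j)
     in (i, LEAST j. is_gecp_pivot k A i j))"

definition eliminate :: "nat \<Rightarrow> real mat \<Rightarrow> real mat" where
  "eliminate k A = mat (dim_row A) (dim_col A)
     (\<lambda>(i, j). if k < i then A $$ (i, j) - A $$ (i, k) / A $$ (k, k) * A $$ (k, j)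
               else A $$ (i, j))"

definition ge_step :: "pivoting \<Rightarrow> nat \<Rightarrow> real mat \<Rightarrow> real mat" where
  "ge_step P k A = (let (i, j) = P k A in eliminate k (swaprows k i (swapcols k j A)))"

text \<open>\<open>ge P A k\<close> is the matrix before step \<open>k\<close>. For an \<open>n \<times> n\<close> matrix the last step is \<open>n - 2\<close>, so
  the matrices produced by the elimination are \<open>ge P A 0, \<dots>, ge P A (n - 1)\<close>.\<close>

primrec ge :: "pivoting \<Rightarrow> real mat \<Rightarrow> nat \<Rightarrow> real mat" where
  "ge P A 0 = A"
| "ge P A (Suc k) = ge_step P k (ge P A k)"

definition growth_factor :: "pivoting \<Rightarrow> real mat \<Rightarrow> real" where
  "growth_factor P A =
     Max {\<bar>ge P A k $$ (i, j)\<bar> | i j k. i < dim_row A \<and> j < dim_col A \<and> k < dim_row A} /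
     Max {\<bar>A $$ (i, j)\<bar> | i j. i < dim_row A \<and> j < dim_col A}"

abbreviation growth_GEPP :: "real mat \<Rightarrow> real" where
  "growth_GEPP \<equiv> growth_factor gepp_pivot"

abbreviation growth_GECP :: "real mat \<Rightarrow> real" where
  "growth_GECP \<equiv> growth_factor gecp_pivot"

end

theory Submission
  imports Defs "Jordan_Normal_Form.Determinant"
begin

text \<open>
  Both strategies choose a pivot that is maximal in its column, so all multipliers have absolute
  value at most 1 and one step at most doubles the largest entry (\<open>column_max_growth\<close>).
  The \<open>n - 1\<close> steps of GEPP therefore give growth at most \<open>2 ^ (n - 1)\<close>. Every growth
  factor of a nonzero matrix is at least 1, because the elimination starts at the matrix itself,
  and the upper bound on the difference follows.

  For equality, one matrix must have growth exactly \<open>2 ^ (n - 1)\<close> under GEPP and exactly 1 under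
  GECP. Take Wilkinson's matrix, with last column 1 and, in the other columns, 1 on the diagonal
  and -1 below it; GEPP swaps no rows on it and doubles the last column below the pivot in each
  step. The doubling is insensitive to the scale of the first \<open>n - 1\<close> columns, so these may be
  multiplied by a small \<open>c > 0\<close>. For \<open>c < 1\<close>, GECP has to start with the last entry of row 0.
  This single step clears the column of ones and leaves a trailing block with entries of size at
  most \<open>2 * c\<close>; the other \<open>n - 2\<close> steps can enlarge this block to at most \<open>2 ^ (n - 1) * c\<close>,
  which is 1 for \<open>c = 1 / 2 ^ (n - 1)\<close>.
\<close>

section \<open>Growth under pivots that are maximal in their column\<close>

definition column_max_pivoting :: "pivoting \<Rightarrow> bool" where
  "column_max_pivoting P \<longleftrightarrow>
     (\<forall>n k A. A \<in> carrier_mat n n \<longrightarrow> k < n \<longrightarrow>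
        (case P k A of (p, q) \<Rightarrow> p \<in> {k..<n} \<and> q \<in> {k..<n} \<and>
           (\<forall>i \<in> {k..<n}. \<bar>A $$ (i, q)\<bar> \<le> \<bar>A $$ (p, q)\<bar>)))"

lemma column_max_pivotingE:
  assumes "column_max_pivoting P" "A \<in> carrier_mat n n" "k < n"
  obtains p q where "P k A = (p, q)" "k \<le> p" "p < n" "k \<le> q" "q < n"
    "\<And>i. k \<le> i \<Longrightarrow> i < n \<Longrightarrow> \<bar>A $$ (i, q)\<bar> \<le> \<bar>A $$ (p, q)\<bar>"
proof -
  obtain p q where pq: "P k A = (p, q)" using prod.exhaust by metis
  have "p \<in> {k..<n} \<and> q \<in> {k..<n} \<and> (\<forall>i \<in> {k..<n}. \<bar>A $$ (i, q)\<bar> \<le> \<bar>A $$ (p, q)\<bar>)"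
    using assms(1)[unfolded column_max_pivoting_def, THEN spec, THEN spec, THEN spec,
        THEN mp, THEN mp, OF assms(2,3)]
    unfolding pq prod.case .
  then show thesis by (intro that[OF pq]) simp_all
qed

lemma ex_max_finite:
  fixes f :: "'a \<Rightarrow> real"
  assumes "finite S" "S \<noteq> {}"
  shows "\<exists>x\<in>S. \<forall>y\<in>S. f y \<le> f x"
proof -
  have "Max (f ` S) \<in> f ` S" using assms by (intro Max_in) auto
  then obtain x where "x \<in> S" "f x = Max (f ` S)" by (metis imageE)
  then show ?thesis using assms by (metis Max_ge finite_imageI imageI)
qed

lemma column_max_gepp: "column_max_pivoting gepp_pivot"
  unfolding column_max_pivoting_def
proof (intro allI impI)
  fix n k :: nat and A :: "real mat"
  assume A: "A \<in> carrier_mat n n" and k: "k < n"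
  let ?P = "\<lambda>i. i \<in> {k..<n} \<and> (\<forall>i' \<in> {k..<n}. \<bar>A $$ (i', k)\<bar> \<le> \<bar>A $$ (i, k)\<bar>)"
  have "\<exists>i. ?P i" using ex_max_finite[of "{k..<n}" "\<lambda>i. \<bar>A $$ (i, k)\<bar>"] k by auto
  then have "?P (LEAST i. ?P i)" by (rule LeastI_ex)
  then show "case gepp_pivot k A of (p, q) \<Rightarrow> p \<in> {k..<n} \<and> q \<in> {k..<n} \<and>
      (\<forall>i \<in> {k..<n}. \<bar>A $$ (i, q)\<bar> \<le> \<bar>A $$ (p, q)\<bar>)"
    using A k unfolding gepp_pivot_def by simp
qed

lemma is_gecp_pivot_gecp_pivot:
  assumes "A \<in> carrier_mat n n" "k < n"
  shows "is_gecp_pivot k A (fst (gecp_pivot k A)) (snd (gecp_pivot k A))"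
proof -
  obtain x where "x \<in> {k..<n} \<times> {k..<n}" "\<forall>y \<in> {k..<n} \<times> {k..<n}. \<bar>A $$ y\<bar> \<le> \<bar>A $$ x\<bar>"
    using ex_max_finite[of "{k..<n} \<times> {k..<n}" "\<lambda>x. \<bar>A $$ x\<bar>"] assms by auto
  then have "is_gecp_pivot k A (fst x) (snd x)"
    using assms by (cases x) (simp add: is_gecp_pivot_def)
  then have "\<exists>i j. is_gecp_pivot k A i j" by blast
  then have "\<exists>j. is_gecp_pivot k A (LEAST i. \<exists>j. is_gecp_pivot k A i j) j"
    by (rule LeastI_ex)
  then show ?thesis unfolding gecp_pivot_def Let_def fst_conv snd_conv by (rule LeastI_ex)
qed

lemma column_max_gecp: "column_max_pivoting gecp_pivot"
  unfolding column_max_pivoting_def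
proof (intro allI impI)
  fix n k :: nat and A :: "real mat"
  assume A: "A \<in> carrier_mat n n" and k: "k < n"
  show "case gecp_pivot k A of (p, q) \<Rightarrow> p \<in> {k..<n} \<and> q \<in> {k..<n} \<and>
      (\<forall>i \<in> {k..<n}. \<bar>A $$ (i, q)\<bar> \<le> \<bar>A $$ (p, q)\<bar>)"
    using is_gecp_pivot_gecp_pivot[OF A k] A
    by (cases "gecp_pivot k A") (simp add: is_gecp_pivot_def)
qed

lemma ge_step_entry:
  assumes "A \<in> carrier_mat n n" "P k A = (p, q)" "k < n" "p < n" "q < n" "i < n" "j < n"
  shows "ge_step P k A $$ (i, j) =
    (let s = Transposition.transpose k p; t = Transposition.transpose k q in
     if k < i then A $$ (s i, t j) - A $$ (s i, q) / A $$ (p, q) * A $$ (p, t j)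
     else A $$ (s i, t j))"
  using assms by (auto simp: ge_step_def eliminate_def Transposition.transpose_def)

lemma ge_step_carrier: "A \<in> carrier_mat n n \<Longrightarrow> ge_step P k A \<in> carrier_mat n n"
  by (auto simp: ge_step_def eliminate_def split: prod.split)

lemma ge_carrier: "A \<in> carrier_mat n n \<Longrightarrow> ge P A k \<in> carrier_mat n n"
  by (induction k) (auto intro: ge_step_carrier)

lemma transpose_bounds:
  fixes k :: nat
  assumes "k \<le> p" "p < n" "i < n"
  shows "Transposition.transpose k p i < n"
    "r \<le> k \<Longrightarrow> r \<le> i \<Longrightarrow> r \<le> Transposition.transpose k p i"
  using assms by (auto simp: Transposition.transpose_def)

text \<open>A zero pivot does no harm here: it makes the pivot column zero from row \<open>k\<close> on, and all
  multipliers are then \<open>0 / 0 = 0\<close>.\<close>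

lemma ge_step_doubles:
  assumes "column_max_pivoting P" "A \<in> carrier_mat n n" "r \<le> k" "k < n"
    and bound: "\<And>i j. r \<le> i \<Longrightarrow> i < n \<Longrightarrow> j < n \<Longrightarrow> \<bar>A $$ (i, j)\<bar> \<le> c"
    and ij: "r \<le> i" "i < n" "j < n"
  shows "\<bar>ge_step P k A $$ (i, j)\<bar> \<le> 2 * c"
proof -
  obtain p q where pq: "P k A = (p, q)" "k \<le> p" "p < n" "k \<le> q" "q < n"
    and max: "\<And>i. k \<le> i \<Longrightarrow> i < n \<Longrightarrow> \<bar>A $$ (i, q)\<bar> \<le> \<bar>A $$ (p, q)\<bar>"
    by (rule column_max_pivotingE[OF assms(1,2,4)]) blast
  define s t where "s = Transposition.transpose k p i" and "t = Transposition.transpose k q j"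
  have st: "s < n" "t < n" "r \<le> s"
    using transpose_bounds(1)[OF pq(2,3) ij(2)] transpose_bounds(1)[OF pq(4,5) ij(3)]
      transpose_bounds(2)[OF pq(2,3) ij(2) \<open>r \<le> k\<close> ij(1)]
    unfolding s_def t_def by blast+
  have 1: "\<bar>A $$ (s, t)\<bar> \<le> c" and 2: "\<bar>A $$ (p, t)\<bar> \<le> c"
    using bound[of s t] bound[of p t] st pq(2,3) \<open>r \<le> k\<close> by linarith+
  have entry: "ge_step P k A $$ (i, j) =
      (if k < i then A $$ (s, t) - A $$ (s, q) / A $$ (p, q) * A $$ (p, t) else A $$ (s, t))"
    using ge_step_entry[where P = P and k = k, OF assms(2) pq(1) assms(4) pq(3,5) ij(2,3)]
    unfolding Let_def s_def t_def .
  show ?thesis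
  proof (cases "k < i")
    case False
    then show ?thesis using entry 1 by simp
  next
    case True
    let ?m = "A $$ (s, q) / A $$ (p, q)"
    have "\<bar>A $$ (s, q)\<bar> \<le> \<bar>A $$ (p, q)\<bar>"
      using max[of s] transpose_bounds(2)[OF pq(2,3) ij(2), of k] True st(1)
      unfolding s_def by linarith
    then have "\<bar>?m\<bar> \<le> 1" by (auto simp: divide_le_eq_1)
    then have "\<bar>?m * A $$ (p, t)\<bar> \<le> 1 * c"
      unfolding abs_mult using 2 by (intro mult_mono) auto
    then have "\<bar>A $$ (s, t) - ?m * A $$ (p, t)\<bar> \<le> 2 * c" using 1 by linarith
    then show ?thesis unfolding entry if_P[OF True] .
  qed
qed

text \<open>Only column swaps can still affect a row above the pivot.\<close>

lemma ge_step_preserves_upper_row: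
  assumes "column_max_pivoting P" "A \<in> carrier_mat n n" "i < k" "k < n"
    and bound: "\<And>j. j < n \<Longrightarrow> \<bar>A $$ (i, j)\<bar> \<le> d"
    and j: "j < n"
  shows "\<bar>ge_step P k A $$ (i, j)\<bar> \<le> d"
proof -
  obtain p q where pq: "P k A = (p, q)" "k \<le> p" "p < n" "k \<le> q" "q < n"
    by (rule column_max_pivotingE[OF assms(1,2,4)]) blast
  have i: "i < n" "Transposition.transpose k p i = i"
    using pq \<open>i < k\<close> \<open>k < n\<close> by (auto simp: Transposition.transpose_def)
  have "ge_step P k A $$ (i, j) = A $$ (i, Transposition.transpose k q j)"
    using ge_step_entry[where P = P and k = k, OF assms(2) pq(1) assms(4) pq(3,5) i(1) j]
    unfolding Let_def i(2) if_not_P[OF less_not_sym[OF \<open>i < k\<close>]] .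
  then show ?thesis
    using bound transpose_bounds(1)[OF pq(4,5) j] by (simp only:)
qed

text \<open>Starting the count at an arbitrary step \<open>r\<close>, with separate bounds for the finished rows and
  for the active block, makes the same estimate usable for a whole run (\<open>r = 0\<close>) and for the part
  of a run after a special first step (\<open>r = 1\<close>).\<close>

lemma column_max_growth:
  assumes P: "column_max_pivoting P" and A: "A \<in> carrier_mat n n" and "r \<le> k" "k < n"
    and active: "\<And>i j. r \<le> i \<Longrightarrow> i < n \<Longrightarrow> j < n \<Longrightarrow> \<bar>ge P A r $$ (i, j)\<bar> \<le> c"
    and finished: "\<And>i j. i < r \<Longrightarrow> j < n \<Longrightarrow> \<bar>ge P A r $$ (i, j)\<bar> \<le> d"
    and "i < n" "j < n"
  shows "\<bar>ge P A k $$ (i, j)\<bar> \<le> (if r \<le> i then 2 ^ (k - r) * c else d)"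
  using \<open>r \<le> k\<close> \<open>k < n\<close> \<open>i < n\<close> \<open>j < n\<close>
proof (induction k arbitrary: i j rule: dec_induct)
  case base
  then show ?case using active finished by simp
next
  case (step k)
  have "k < n" using step.prems by simp
  note C = ge_carrier[OF A, of P k]
  show ?case
  proof (cases "r \<le> i")
    case True
    have "\<bar>ge_step P k (ge P A k) $$ (i, j)\<bar> \<le> 2 * (2 ^ (k - r) * c)"
    proof (rule ge_step_doubles[OF P C \<open>r \<le> k\<close> \<open>k < n\<close> _ True \<open>i < n\<close> \<open>j < n\<close>])
      fix i j assume "r \<le> i" "i < n" "j < n"
      then show "\<bar>ge P A k $$ (i, j)\<bar> \<le> 2 ^ (k - r) * c"
        using step.IH[OF \<open>k < n\<close>, of i j] by simp
    qed
    then show ?thesis using True \<open>r \<le> k\<close> by (simp add: Suc_diff_le mult.assoc)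
  next
    case False
    have "\<bar>ge_step P k (ge P A k) $$ (i, j)\<bar> \<le> d"
    proof (rule ge_step_preserves_upper_row[OF P C _ \<open>k < n\<close> _ \<open>j < n\<close>])
      show "i < k" using False \<open>r \<le> k\<close> by simp
      fix j assume "j < n"
      then show "\<bar>ge P A k $$ (i, j)\<bar> \<le> d"
        using step.IH[OF \<open>k < n\<close>, of i j] False \<open>i < n\<close> by simp
    qed
    then show ?thesis using False by simp
  qed
qed

section \<open>Growth factors as extrema\<close>

definition max_entry :: "real mat \<Rightarrow> real" where
  "max_entry A = Max {\<bar>A $$ (i, j)\<bar> | i j. i < dim_row A \<and> j < dim_col A}"

lemma finite_entries: "finite {\<bar>A $$ (i, j) :: real\<bar> | i j. i < m \<and> j < n}"
proof -
  have "{\<bar>A $$ (i, j)\<bar> | i j. i < m \<and> j < n} = (\<lambda>(i, j). \<bar>A $$ (i, j)\<bar>) ` ({..<m} \<times> {..<n})"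
    by auto
  then show ?thesis by simp
qed

lemma finite_ge_entries:
  "finite {\<bar>ge P A k $$ (i, j)\<bar> | i j k. i < m \<and> j < n \<and> k < l}"
proof -
  have "{\<bar>ge P A k $$ (i, j)\<bar> | i j k. i < m \<and> j < n \<and> k < l} =
    (\<lambda>(i, j, k). \<bar>ge P A k $$ (i, j)\<bar>) ` ({..<m} \<times> {..<n} \<times> {..<l})"
    by force
  then show ?thesis by simp
qed

lemma entry_le_max_entry:
  "A \<in> carrier_mat n n \<Longrightarrow> i < n \<Longrightarrow> j < n \<Longrightarrow> \<bar>A $$ (i, j)\<bar> \<le> max_entry A"
  unfolding max_entry_def by (rule Max_ge[OF finite_entries]) auto

lemma max_entry_nonneg:
  assumes "A \<in> carrier_mat n n" "n \<ge> 1"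
  shows "max_entry A \<ge> 0"
  using entry_le_max_entry[OF assms(1), of 0 0] assms(2) by auto

lemma max_entry_eqI:
  assumes "A \<in> carrier_mat n n" "i < n" "j < n" "\<bar>A $$ (i, j)\<bar> = m"
    and "\<And>i j. i < n \<Longrightarrow> j < n \<Longrightarrow> \<bar>A $$ (i, j)\<bar> \<le> m"
  shows "max_entry A = m"
  unfolding max_entry_def using assms by (intro Max_eqI[OF finite_entries]) auto

lemma growth_factor_max_entry:
  "growth_factor P A =
     Max {\<bar>ge P A k $$ (i, j)\<bar> | i j k. i < dim_row A \<and> j < dim_col A \<and> k < dim_row A} /
     max_entry A"
  unfolding growth_factor_def max_entry_def ..

lemma growth_factor_ge:
  assumes A: "A \<in> carrier_mat n n" and "i < n" "j < n" "k < n"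
  shows "\<bar>ge P A k $$ (i, j)\<bar> / max_entry A \<le> growth_factor P A"
  unfolding growth_factor_max_entry
proof (rule divide_right_mono)
  show "\<bar>ge P A k $$ (i, j)\<bar> \<le>
     Max {\<bar>ge P A k $$ (i, j)\<bar> | i j k. i < dim_row A \<and> j < dim_col A \<and> k < dim_row A}"
    using assms by (intro Max_ge[OF finite_ge_entries]) auto
  show "0 \<le> max_entry A" using max_entry_nonneg[OF A] \<open>i < n\<close> by simp
qed

lemma growth_factor_le:
  assumes A: "A \<in> carrier_mat n n" and "n \<ge> 1" "c \<ge> 0"
    and bound: "\<And>i j k. i < n \<Longrightarrow> j < n \<Longrightarrow> k < n \<Longrightarrow> \<bar>ge P A k $$ (i, j)\<bar> \<le> c * max_entry A"
  shows "growth_factor P A \<le> c"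
proof -
  let ?S = "{\<bar>ge P A k $$ (i, j)\<bar> | i j k. i < dim_row A \<and> j < dim_col A \<and> k < dim_row A}"
  have "\<bar>ge P A 0 $$ (0, 0)\<bar> \<in> ?S"
    using A \<open>n \<ge> 1\<close> by (intro CollectI exI[of _ 0]) auto
  then have "Max ?S \<le> c * max_entry A"
    using A bound by (subst Max_le_iff[OF finite_ge_entries]) auto
  then have "growth_factor P A \<le> c * max_entry A / max_entry A"
    unfolding growth_factor_max_entry
    by (rule divide_right_mono[OF _ max_entry_nonneg[OF A \<open>n \<ge> 1\<close>]])
  then show ?thesis using \<open>c \<ge> 0\<close> by (cases "max_entry A = 0") auto
qed

text \<open>The largest entry of \<open>A\<close> already occurs in stage 0 of the elimination.\<close>

lemma growth_factor_ge_1: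
  assumes A: "A \<in> carrier_mat n n" and "n \<ge> 1" "max_entry A \<noteq> 0"
  shows "growth_factor P A \<ge> 1"
proof -
  let ?S = "{\<bar>A $$ (i, j)\<bar> | i j. i < dim_row A \<and> j < dim_col A}"
  have "\<bar>A $$ (0, 0)\<bar> \<in> ?S" using A \<open>n \<ge> 1\<close> by force
  then have "max_entry A \<in> ?S"
    unfolding max_entry_def by (intro Max_in[OF finite_entries]) auto
  then obtain i j where "i < n" "j < n" "max_entry A = \<bar>A $$ (i, j)\<bar>" using A by auto
  then show ?thesis
    using growth_factor_ge[OF A, of i j 0 P] \<open>max_entry A \<noteq> 0\<close> by simp
qed

lemma column_max_growth_factor_le:
  assumes P: "column_max_pivoting P" and A: "A \<in> carrier_mat n n" and "n \<ge> 1"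
  shows "growth_factor P A \<le> 2 ^ (n - 1)"
proof (rule growth_factor_le[OF A \<open>n \<ge> 1\<close>])
  fix i j k assume ijk: "i < n" "j < n" "k < n"
  have "\<bar>ge P A k $$ (i, j)\<bar> \<le> (if 0 \<le> i then 2 ^ (k - 0) * max_entry A else 0)"
    by (rule column_max_growth[OF P A]) (use ijk entry_le_max_entry[OF A] in auto)
  also have "\<dots> \<le> 2 ^ (n - 1) * max_entry A"
    using ijk max_entry_nonneg[OF A \<open>n \<ge> 1\<close>] by (auto intro!: mult_right_mono power_increasing)
  finally show "\<bar>ge P A k $$ (i, j)\<bar> \<le> 2 ^ (n - 1) * max_entry A" .
qed simp

section \<open>Wilkinson's matrix with small leading columns\<close>

text \<open>The case \<open>k = 0\<close> is the extremal matrix; for \<open>k < n\<close> and \<open>c \<noteq> 0\<close> this is what GEPP makes of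
  it in \<open>k\<close> steps.\<close>

definition wilkinson_stage :: "nat \<Rightarrow> real \<Rightarrow> nat \<Rightarrow> real mat" where
  "wilkinson_stage n c k = mat n n (\<lambda>(i, j).
     if j = n - 1 then 2 ^ min i k
     else if i = j then c
     else if k \<le> j \<and> j < i then - c
     else 0)"

lemma wilkinson_stage_carrier: "wilkinson_stage n c k \<in> carrier_mat n n"
  by (simp add: wilkinson_stage_def)

lemma wilkinson_stage_entry:
  assumes "i < n" "j < n"
  shows "wilkinson_stage n c k $$ (i, j) =
    (if j = n - 1 then 2 ^ min i k else if i = j then c else if k \<le> j \<and> j < i then - c else 0)"
  using assms by (simp add: wilkinson_stage_def)

lemma gepp_pivot_wilkinson_stage:
  assumes "Suc k < n"
  shows "gepp_pivot k (wilkinson_stage n c k) = (k, k)"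
proof -
  have "(LEAST i. i \<in> {k..<n} \<and> (\<forall>i' \<in> {k..<n}.
      \<bar>wilkinson_stage n c k $$ (i', k)\<bar> \<le> \<bar>wilkinson_stage n c k $$ (i, k)\<bar>)) = k"
    by (rule Least_equality) (use assms in \<open>auto simp: wilkinson_stage_def\<close>)
  then show ?thesis by (simp add: gepp_pivot_def wilkinson_stage_def)
qed

lemma gepp_step_wilkinson_stage:
  assumes "Suc k < n" "c \<noteq> 0"
  shows "ge_step gepp_pivot k (wilkinson_stage n c k) = wilkinson_stage n c (Suc k)"
proof (rule eq_matI)
  fix i j assume "i < dim_row (wilkinson_stage n c (Suc k))"
    and "j < dim_col (wilkinson_stage n c (Suc k))"
  then have ij: "i < n" "j < n" by (auto simp: wilkinson_stage_def)
  have k: "k < n" using assms by simp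
  show "ge_step gepp_pivot k (wilkinson_stage n c k) $$ (i, j) =
      wilkinson_stage n c (Suc k) $$ (i, j)"
    unfolding Let_def ge_step_entry[where P = gepp_pivot and k = k,
        OF wilkinson_stage_carrier gepp_pivot_wilkinson_stage[OF assms(1)] k k k ij]
    using ij assms
    by (auto simp: wilkinson_stage_entry min_def less_Suc_eq le_Suc_eq) (simp flip: power_Suc)
qed (simp_all add: carrier_matD[OF wilkinson_stage_carrier]
    carrier_matD[OF ge_step_carrier[OF wilkinson_stage_carrier]])

lemma gepp_wilkinson:
  assumes "c \<noteq> 0" "k < n"
  shows "ge gepp_pivot (wilkinson_stage n c 0) k = wilkinson_stage n c k"
  using \<open>k < n\<close> by (induction k) (simp_all add: gepp_step_wilkinson_stage \<open>c \<noteq> 0\<close>)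

lemma max_entry_wilkinson:
  assumes "n \<ge> 1" "0 < c" "c \<le> 1"
  shows "max_entry (wilkinson_stage n c 0) = 1"
  by (rule max_entry_eqI[OF wilkinson_stage_carrier, of 0 n "n - 1"])
    (use assms in \<open>auto simp: wilkinson_stage_def\<close>)

lemma growth_GEPP_wilkinson:
  assumes "n \<ge> 1" "0 < c" "c \<le> 1"
  shows "growth_GEPP (wilkinson_stage n c 0) = 2 ^ (n - 1)"
proof (rule antisym)
  show "growth_GEPP (wilkinson_stage n c 0) \<le> 2 ^ (n - 1)"
    using column_max_growth_factor_le[OF column_max_gepp wilkinson_stage_carrier \<open>n \<ge> 1\<close>] .
  have "ge gepp_pivot (wilkinson_stage n c 0) (n - 1) $$ (n - 1, n - 1) = 2 ^ (n - 1)"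
    using assms gepp_wilkinson[of c "n - 1" n] by (simp add: wilkinson_stage_def)
  then show "2 ^ (n - 1) \<le> growth_GEPP (wilkinson_stage n c 0)"
    using growth_factor_ge[OF wilkinson_stage_carrier[of n c 0], of "n - 1" "n - 1" "n - 1" gepp_pivot]
      max_entry_wilkinson[OF assms] assms by simp
qed

text \<open>Apart from the last column all entries are smaller than 1, so GECP must take its first pivot
  from the last column, and the tie among its ones goes to row 0.\<close>

lemma gecp_pivot_wilkinson:
  assumes "n \<ge> 2" "0 < c" "c < 1"
  shows "gecp_pivot 0 (wilkinson_stage n c 0) = (0, n - 1)"
proof -
  let ?A = "wilkinson_stage n c 0"
  have piv: "is_gecp_pivot 0 ?A 0 j \<longleftrightarrow> j = n - 1" for j
  proof
    assume "is_gecp_pivot 0 ?A 0 j"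
    then have "\<bar>?A $$ (0, n - 1)\<bar> \<le> \<bar>?A $$ (0, j)\<bar>" "j < n"
      using assms wilkinson_stage_carrier[of n c 0] by (auto simp: is_gecp_pivot_def)
    then show "j = n - 1" using assms by (auto simp: wilkinson_stage_def split: if_splits)
  next
    assume "j = n - 1"
    then show "is_gecp_pivot 0 ?A 0 j"
      using assms by (auto simp: is_gecp_pivot_def wilkinson_stage_def)
  qed
  have "(LEAST i. \<exists>j. is_gecp_pivot 0 ?A i j) = 0"
    by (rule Least_equality) (use piv in auto)
  moreover have "(LEAST j. is_gecp_pivot 0 ?A 0 j) = n - 1"
    by (rule Least_equality) (simp_all add: piv)
  ultimately show ?thesis by (simp only: gecp_pivot_def Let_def)
qed

text \<open>Subtracting row 0 from the others cancels the ones against each other; what is left are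
  differences of entries of the small columns.\<close>

lemma gecp_first_step_wilkinson:
  assumes "n \<ge> 2" "0 < c" "c < 1" "i < n" "j < n"
  shows "\<bar>ge gecp_pivot (wilkinson_stage n c 0) 1 $$ (i, j)\<bar> \<le> (if 1 \<le> i then 2 * c else 1)"
proof -
  have n: "0 < n" "n - 1 < n" using assms by auto
  show ?thesis
    unfolding One_nat_def ge.simps Let_def ge_step_entry[where P = gecp_pivot and k = 0,
        OF wilkinson_stage_carrier gecp_pivot_wilkinson[OF assms(1-3)] n(1) n(1) n(2) assms(4,5)]
    using assms by (auto simp: wilkinson_stage_entry Transposition.transpose_def)
qed

lemma growth_GECP_wilkinson:
  assumes "n \<ge> 1"
  shows "growth_GECP (wilkinson_stage n (1 / 2 ^ (n - 1)) 0) = 1"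
proof -
  define c :: real where "c = 1 / 2 ^ (n - 1)"
  let ?A = "wilkinson_stage n c 0"
  have c: "0 < c" "c \<le> 1" by (auto simp: c_def)
  have max: "max_entry ?A = 1" by (rule max_entry_wilkinson[OF assms c])
  have "growth_GECP ?A \<le> 1"
  proof (rule growth_factor_le[OF wilkinson_stage_carrier assms])
    fix i j k assume ijk: "i < n" "j < n" "k < n"
    show "\<bar>ge gecp_pivot ?A k $$ (i, j)\<bar> \<le> 1 * max_entry ?A"
    proof (cases "k = 0")
      case True
      then show ?thesis
        using entry_le_max_entry[OF wilkinson_stage_carrier ijk(1,2)] by simp
    next
      case False
      then obtain m where n: "n = Suc (Suc m)"
        using ijk by (metis less_nat_zero_code not_less_eq not0_implies_Suc less_Suc0)
      have c1: "c < 1"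
        using one_less_power[of "2::real" "Suc m"] by (simp add: c_def n)
      have first: "\<bar>ge gecp_pivot ?A 1 $$ (i, j)\<bar> \<le> (if 1 \<le> i then 2 * c else 1)"
        if "i < n" "j < n" for i j
        using gecp_first_step_wilkinson[OF _ c(1) c1 that] n by simp
      have "\<bar>ge gecp_pivot ?A k $$ (i, j)\<bar> \<le> (if 1 \<le> i then 2 ^ (k - 1) * (2 * c) else 1)"
      proof (rule column_max_growth[OF column_max_gecp wilkinson_stage_carrier])
        show "\<bar>ge gecp_pivot ?A 1 $$ (i, j)\<bar> \<le> 2 * c" if "1 \<le> i" "i < n" "j < n" for i j
          using first[OF that(2,3)] that(1) by simp
        show "\<bar>ge gecp_pivot ?A 1 $$ (i, j)\<bar> \<le> 1" if "i < 1" "j < n" for i j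
          using first[of i j] that assms by simp
      qed (use False ijk in auto)
      moreover have "(2::real) ^ (k - 1) * (2 * c) \<le> 1"
      proof -
        have "(2::real) ^ (k - 1) \<le> 2 ^ m" using ijk n by (intro power_increasing) auto
        then show ?thesis by (simp add: c_def n field_simps)
      qed
      ultimately show ?thesis using max by (auto split: if_splits)
    qed
  qed simp
  moreover have "growth_GECP ?A \<ge> 1"
    using growth_factor_ge_1[OF wilkinson_stage_carrier assms] max by simp
  ultimately show ?thesis by (simp add: c_def)
qed

text \<open>Elimination without swaps factors the matrix as \<open>L * U\<close>, where all multipliers in \<open>L\<close> are -1
  and \<open>U\<close> is the last stage; the last column comes out right because
  \<open>2 ^ i - (\<Sum>l<i. 2 ^ l) = 1\<close>.\<close>

lemma wilkinson_LU:
  "wilkinson_stage n c 0 =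
     mat n n (\<lambda>(i, j). if i = j then 1 else if j < i then - 1 else 0) *
     wilkinson_stage n c (n - 1)"
    (is "_ = ?L * ?U")
proof (rule eq_matI)
  fix i j assume "i < dim_row (?L * ?U)" and "j < dim_col (?L * ?U)"
  then have ij: "i < n" "j < n" by (auto simp: wilkinson_stage_def)
  have "(?L * ?U) $$ (i, j) = (\<Sum>l\<in>{0..<n}. ?L $$ (i, l) * ?U $$ (l, j))"
    using ij by (simp add: times_mat_def scalar_prod_def wilkinson_stage_def)
  also have "\<dots> = (\<Sum>l\<in>{0..<Suc i}. ?L $$ (i, l) * ?U $$ (l, j))"
    by (rule sum.mono_neutral_right) (use ij in auto)
  also have "\<dots> = ?U $$ (i, j) - (\<Sum>l\<in>{0..<i}. ?U $$ (l, j))"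
    using ij by (simp add: sum_negf)
  also have "\<dots> = wilkinson_stage n c 0 $$ (i, j)"
  proof (cases "j = n - 1")
    case True
    have "(\<Sum>l\<in>{0..<i}. ?U $$ (l, j)) = (\<Sum>l\<in>{0..<i}. 2 ^ l)"
      using ij True by (intro sum.cong) (auto simp: wilkinson_stage_def min_def)
    also have "\<dots> = 2 ^ i - 1"
      by (induction i) auto
    finally show ?thesis using ij True by (auto simp: wilkinson_stage_def min_def)
  next
    case False
    have "(\<Sum>l\<in>{0..<i}. ?U $$ (l, j)) = (\<Sum>l\<in>{0..<i}. if l = j then c else 0)"
      using ij False by (intro sum.cong) (auto simp: wilkinson_stage_def)
    then show ?thesis using ij False by (auto simp: wilkinson_stage_def)
  qed
  finally show "wilkinson_stage n c 0 $$ (i, j) = (?L * ?U) $$ (i, j)" ..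
qed (auto simp: wilkinson_stage_def)

lemma det_nonzero_in_GL:
  assumes A: "A \<in> carrier_mat n n" and "det A \<noteq> 0"
  shows "A \<in> GL n"
proof -
  obtain B where "B \<in> carrier_mat n n" "B * A = 1\<^sub>m n" "A * B = 1\<^sub>m n"
    using det_non_zero_imp_unit[OF assms, of "()"] unfolding Units_def ring_mat_def by auto
  then show ?thesis using A by (auto simp: GL_def invertible_mat_def inverts_mat_def)
qed

lemma wilkinson_in_GL:
  assumes "c \<noteq> 0"
  shows "wilkinson_stage n c 0 \<in> GL n"
proof (rule det_nonzero_in_GL[OF wilkinson_stage_carrier])
  let ?L = "mat n n (\<lambda>(i, j). if i = j then 1 else if j < i then - 1 else 0) :: real mat"
  let ?U = "wilkinson_stage n c (n - 1)"
  have "det ?L = prod_list (diag_mat ?L)" by (rule det_lower_triangular[of n]) auto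
  then have "det ?L \<noteq> 0" by (simp add: prod_list_diag_prod)
  moreover have "det ?U = prod_list (diag_mat ?U)"
    by (rule det_upper_triangular[OF _ wilkinson_stage_carrier])
      (auto simp: wilkinson_stage_def upper_triangular_def)
  then have "det ?U \<noteq> 0" using assms by (simp add: prod_list_diag_prod wilkinson_stage_def)
  moreover have "det (wilkinson_stage n c 0) = det ?L * det ?U"
    unfolding wilkinson_LU[of n c] by (rule det_mult[OF _ wilkinson_stage_carrier]) simp
  ultimately show "det (wilkinson_stage n c 0) \<noteq> 0" by simp
qed

theorem proposition2p1:
  fixes n :: nat
  assumes "n \<ge> 1"
  shows "(\<exists>A \<in> GL n. growth_GEPP A - growth_GECP A = 2 ^ (n - 1) - 1) \<and>
         (\<forall>A \<in> GL n. growth_GEPP A - growth_GECP A \<le> 2 ^ (n - 1) - 1)"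
proof (intro conjI bexI ballI)
  show "growth_GEPP (wilkinson_stage n (1 / 2 ^ (n - 1)) 0) -
      growth_GECP (wilkinson_stage n (1 / 2 ^ (n - 1)) 0) = 2 ^ (n - 1) - 1"
    using growth_GEPP_wilkinson[OF assms, of "1 / 2 ^ (n - 1)"] growth_GECP_wilkinson[OF assms]
    by simp
  show "wilkinson_stage n (1 / 2 ^ (n - 1)) 0 \<in> GL n" by (rule wilkinson_in_GL) simp
next
  fix A assume "A \<in> GL n"
  then have A: "A \<in> carrier_mat n n" by (simp add: GL_def)
  show "growth_GEPP A - growth_GECP A \<le> 2 ^ (n - 1) - 1"
  proof (cases "max_entry A = 0")
    case True
    \<comment> \<open>Division by 0 gives both growth factors the value 0.\<close>
    then show ?thesis by (simp add: growth_factor_max_entry)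
  next
    case False
    then show ?thesis
      using column_max_growth_factor_le[OF column_max_gepp A assms]
        growth_factor_ge_1[OF A assms False, of gecp_pivot] by simp
  qed
qed

end
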